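(* Let $n \ge 7$ and let $M \in \mathcal{S}_n$ be a singular maximizer of $C_3$. Then $M$ is nontrivial if and only if $M$ is strongly connected.
   Context: A tournament of order $n$ is an orientation of the complete graph on $n$ vertices; a tournament matrix of order $n$ is its adjacency matrix, i.e. an $n \times n$ $(0,1)$-matrix $M$ with $M + M^T = J_n - I_n$ ($J_n$ all-ones, $I_n$ identity). Tournaments and their matrices are identified. $\mathcal{S}_n$ is the set of singular tournament matrices of order $n$ (over the real/complex numbers). $C_3(M)$ is the number of directed $3$-cycles of $M$, counted as $3$-vertex subsets inducing a directed cycle. A matrix $M \in \mathcal{S}_n$ is a singular maximizer of $C_3$ if $C_3(M) = \max_{N \in \mathcal{S}_n} C_3(N)$. A singular maximizer of $C_3$ of order $n$ is called trivial if it is obtained by adding a vertex (with arbitrary arcs between the new vertex and the old ones) to a regular or almost regular tournament of order $n-1$, and nontrivial otherwise. A tournament is regular if all its vertices have the same outdegree; it is almost regular if the maximum difference of outdegrees between its vertices is $1$ (its order is then even). A tournament is strongly connected if for every pair of vertices there is a directed walk from each to the other. *)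

theory Defs
  imports "Jordan_Normal_Form.Determinant" "Graph_Theory.Graph_Theory"
begin

text \<open>
  A tournament on the vertices \<open>0, \<dots>, n - 1\<close> is identified with its adjacency matrix; the arc
  \<open>i \<rightarrow> j\<close> is present iff the entry \<open>(i, j)\<close> is \<open>1\<close>.
\<close>

definition tournament_mat :: "nat \<Rightarrow> real mat \<Rightarrow> bool" where
  "tournament_mat n M \<longleftrightarrow>
     M \<in> carrier_mat n n \<and>
     elements_mat M \<subseteq> {0, 1} \<and>
     M + transpose_mat M = mat n n (\<lambda>_. 1) - 1\<^sub>m n"

definition mat_digraph :: "real mat \<Rightarrow> nat pair_pre_digraph" where
  "mat_digraph M =
     \<lparr> pverts = {..<dim_row M},
       parcs = {(i, j). i < dim_row M \<and> j < dim_row M \<and> M $$ (i, j) = 1} \<rparr>"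

definition singular_tournaments :: "nat \<Rightarrow> real mat set" where
  "singular_tournaments n = {M. tournament_mat n M \<and> det M = 0}"

definition C3 :: "real mat \<Rightarrow> nat" where
  "C3 M = card {S. S \<subseteq> {..<dim_row M} \<and> card S = 3 \<and>
     (\<exists>i j k. S = {i, j, k} \<and> M $$ (i, j) = 1 \<and> M $$ (j, k) = 1 \<and> M $$ (k, i) = 1)}"

definition singular_C3_maximizer :: "nat \<Rightarrow> real mat \<Rightarrow> bool" where
  "singular_C3_maximizer n M \<longleftrightarrow>
     M \<in> singular_tournaments n \<and> C3 M = Max (C3 ` singular_tournaments n)"

definition regular_tournament :: "nat \<Rightarrow> real mat \<Rightarrow> bool" where
  "regular_tournament n M \<longleftrightarrow>
     tournament_mat n M \<and>
     (\<forall>u<n. \<forall>v<n. out_degree (mat_digraph M) u = out_degree (mat_digraph M) v)"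

definition almost_regular_tournament :: "nat \<Rightarrow> real mat \<Rightarrow> bool" where
  "almost_regular_tournament n M \<longleftrightarrow>
     tournament_mat n M \<and>
     Max {\<bar>int (out_degree (mat_digraph M) u) - int (out_degree (mat_digraph M) v)\<bar> | u v.
            u < n \<and> v < n} = 1"

text \<open>
  Vertices are unordered, so the added vertex may sit at any index \<open>v\<close> of \<open>M\<close>.  Its arcs are
  arbitrary, so the only requirement is that deleting row and column \<open>v\<close> of the tournament
  matrix \<open>M\<close> leaves \<open>N\<close>.
\<close>

definition adds_vertex :: "nat \<Rightarrow> real mat \<Rightarrow> real mat \<Rightarrow> bool" where
  "adds_vertex n N M \<longleftrightarrow> tournament_mat n M \<and> (\<exists>v<n. mat_delete M v v = N)"

definition trivial_maximizer :: "nat \<Rightarrow> real mat \<Rightarrow> bool" where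
  "trivial_maximizer n M \<longleftrightarrow>
     singular_C3_maximizer n M \<and>
     (\<exists>N. (regular_tournament (n - 1) N \<or> almost_regular_tournament (n - 1) N) \<and>
          adds_vertex n N M)"

definition nontrivial_maximizer :: "nat \<Rightarrow> real mat \<Rightarrow> bool" where
  "nontrivial_maximizer n M \<longleftrightarrow> singular_C3_maximizer n M \<and> \<not> trivial_maximizer n M"

text \<open>Finiteness makes the maximum of \<^const>\<open>C3\<close> meaningful.\<close>

lemma finite_singular_tournaments: "finite (singular_tournaments n)"
proof -
  let ?I = "{..<n} \<times> {..<n}"
  let ?F = "PiE ?I (\<lambda>_. {0, 1 :: real})"
  have "M \<in> mat n n ` ?F" if "M \<in> singular_tournaments n" for M
  proof
    have M: "M \<in> carrier_mat n n" "elements_mat M \<subseteq> {0, 1}"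
      using that by (auto simp: singular_tournaments_def tournament_mat_def)
    show "M = mat n n (restrict (($$) M) ?I)"
      using M(1) by (intro eq_matI) auto
    have "M $$ p \<in> {0, 1}" if "p \<in> ?I" for p
      using M(2) that elements_matI[OF M(1), of "fst p" "snd p"] by (auto simp: subset_eq)
    then show "restrict (($$) M) ?I \<in> ?F"
      by (intro restrict_PiE_iff[THEN iffD2] ballI)
  qed
  moreover have "finite ?F" by (intro finite_PiE) auto
  ultimately show ?thesis
    using finite_subset[OF subsetI finite_imageI] by blast
qed

end

theory Submission
  imports Defs
begin

text \<open>
  Let the excess of a vertex be its outdegree minus its indegree, and let \<open>D\<close> be the sum of the
  squared excesses.  Then \<open>24 C\<^sub>3 + 3 D = n\<^sup>3 - n\<close>, so maximizing \<open>C\<^sub>3\<close> means minimizing \<open>D\<close>.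

  A kernel vector \<open>x\<close> of \<open>M\<close>, scaled to \<open>\<Sum> x = 1\<close>, satisfies \<open>\<Sum> x\<^sup>2 = 1\<close> and
  \<open>\<Sum> e x = n - 1\<close> for the excess vector \<open>e\<close>, which forces \<open>D \<ge> n (n - 1)\<close>.  If deleting \<open>v\<close>
  leaves a regular or almost regular tournament, all excesses except that of \<open>v\<close> are at most \<open>2\<close>
  in absolute value, so \<open>v\<close> must be a source or a sink.

  Conversely, if a set of \<open>a\<close> vertices dominates the other \<open>b\<close> vertices, then \<open>D\<close> is \<open>a b n\<close> plus
  the values of \<open>D\<close> for the two parts.  Comparison with a sink added to a balanced tournament of
  order \<open>n - 1\<close> forces \<open>a = 1\<close> or \<open>b = 1\<close> and makes the rest regular or almost regular.
\<close>

section \<open>Entrywise form of tournament matrices, and excesses\<close>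

lemma tournament_mat_iff:
  "tournament_mat n M \<longleftrightarrow> M \<in> carrier_mat n n \<and>
     (\<forall>i<n. \<forall>j<n. M $$ (i, j) \<in> {0, 1}) \<and> (\<forall>i<n. M $$ (i, i) = 0) \<and>
     (\<forall>i<n. \<forall>j<n. i \<noteq> j \<longrightarrow> M $$ (i, j) + M $$ (j, i) = 1)"
proof (cases "M \<in> carrier_mat n n")
  case True
  have "elements_mat M \<subseteq> {0, 1} \<longleftrightarrow> (\<forall>i<n. \<forall>j<n. M $$ (i, j) \<in> {0, 1})"
    using True unfolding elements_mat_def by fastforce
  moreover have "M + transpose_mat M = mat n n (\<lambda>_. 1) - 1\<^sub>m n \<longleftrightarrow>
      (\<forall>i<n. M $$ (i, i) = 0) \<and> (\<forall>i<n. \<forall>j<n. i \<noteq> j \<longrightarrow> M $$ (i, j) + M $$ (j, i) = 1)"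
    (is "?L = ?R \<longleftrightarrow> _")
  proof -
    have "?L = ?R \<longleftrightarrow> (\<forall>i<n. \<forall>j<n. ?L $$ (i, j) = ?R $$ (i, j))"
      using True by (auto simp: mat_eq_iff)
    also have "\<dots> \<longleftrightarrow>
        (\<forall>i<n. \<forall>j<n. M $$ (i, j) + M $$ (j, i) = (if i = j then 0 else 1))"
      using True by auto
    also have "\<dots> \<longleftrightarrow>
        (\<forall>i<n. M $$ (i, i) = 0) \<and> (\<forall>i<n. \<forall>j<n. i \<noteq> j \<longrightarrow> M $$ (i, j) + M $$ (j, i) = 1)"
      by (smt (verit, best))
    finally show ?thesis .
  qed
  ultimately show ?thesis using True by (auto simp: tournament_mat_def)
qed (auto simp: tournament_mat_def)

lemma tournament_matD:
  assumes "tournament_mat n M"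
  shows "M \<in> carrier_mat n n" "dim_row M = n"
    "i < n \<Longrightarrow> j < n \<Longrightarrow> M $$ (i, j) = 0 \<or> M $$ (i, j) = 1"
    "i < n \<Longrightarrow> M $$ (i, i) = 0"
    "i < n \<Longrightarrow> j < n \<Longrightarrow> i \<noteq> j \<Longrightarrow> M $$ (i, j) + M $$ (j, i) = 1"
  using assms by (auto simp: tournament_mat_iff)

text \<open>For \<open>u \<in> A\<close> this is the excess of \<open>u\<close> in the subtournament
  induced on \<open>A\<close>. For \<open>u\<close> outside \<open>A\<close> it is the balance of
  the arcs between \<open>u\<close> and \<open>A\<close>, so excesses over disjoint sets add
  up.\<close>

definition excess :: "real mat \<Rightarrow> nat set \<Rightarrow> nat \<Rightarrow> real" where
  "excess M A u = (\<Sum>j\<in>A. M $$ (u, j) - M $$ (j, u))"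

lemma sum_excess: "(\<Sum>u\<in>A. excess M A u) = 0"
proof -
  have "(\<Sum>u\<in>A. \<Sum>j\<in>A. M $$ (j, u)) = (\<Sum>u\<in>A. \<Sum>j\<in>A. M $$ (u, j))"
    by (rule sum.swap)
  then show ?thesis by (simp add: excess_def sum_subtractf)
qed

lemma excess_eq_sum:
  assumes T: "tournament_mat n M" and A: "A \<subseteq> {..<n}" and u: "u \<in> A"
  shows "excess M A u = 2 * (\<Sum>j\<in>A. M $$ (u, j)) - (real (card A) - 1)"
proof -
  have fin: "finite A" using A finite_subset by blast
  \<comment> \<open>Off the diagonal \<open>M $$ (j, u)\<close> is \<open>1 - M $$ (u, j)\<close>.
    The diagonal term is zero, whence \<open>card A - 1\<close> instead of
    \<open>card A\<close>.\<close>
  have "excess M A u = (\<Sum>j\<in>A. 2 * M $$ (u, j) - (if u = j then 0 else 1))"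
    unfolding excess_def
  proof (intro sum.cong refl)
    fix j assume "j \<in> A"
    then have "u < n" "j < n" using A u by auto
    then show "M $$ (u, j) - M $$ (j, u) = 2 * M $$ (u, j) - (if u = j then 0 else 1)"
      using tournament_matD(5)[OF T, of u j] tournament_matD(4)[OF T, of u] by auto
  qed
  also have "\<dots> = 2 * (\<Sum>j\<in>A. M $$ (u, j)) - (\<Sum>j\<in>A. 1 - (if u = j then 1 else 0))"
    unfolding sum_distrib_left sum_subtractf[symmetric] by (intro sum.cong) auto
  also have "(\<Sum>j\<in>A. 1 - (if u = j then 1 else 0)) = real (card A) - 1"
    using fin u by (simp add: sum_subtractf)
  finally show ?thesis .
qed

lemma sum_row_eq_card:
  assumes T: "tournament_mat n M" and A: "A \<subseteq> {..<n}" and u: "u < n"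
  shows "(\<Sum>j\<in>A. M $$ (u, j)) = real (card {j \<in> A. M $$ (u, j) = 1})"
proof -
  have fin: "finite A" using A finite_subset by blast
  have "(\<Sum>j\<in>A. M $$ (u, j)) = (\<Sum>j\<in>A. if M $$ (u, j) = 1 then 1 else 0)"
  proof (intro sum.cong refl)
    fix j assume "j \<in> A"
    then have "j < n" using A by auto
    then show "M $$ (u, j) = (if M $$ (u, j) = 1 then 1 else 0)"
      using tournament_matD(3)[OF T u] by auto
  qed
  also have "\<dots> = real (card {j \<in> A. M $$ (u, j) = 1})"
    using fin by (simp add: sum.If_cases Int_def)
  finally show ?thesis .
qed

text \<open>The integer form makes visible that an excess has the parity of
  \<open>card A - 1\<close>.\<close>

lemma excess_eq_card:
  assumes "tournament_mat n M" "A \<subseteq> {..<n}" "u \<in> A"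
  shows "excess M A u = of_int (2 * int (card {j \<in> A. M $$ (u, j) = 1}) - (int (card A) - 1))"
  using excess_eq_sum[OF assms] sum_row_eq_card[OF assms(1,2), of u] assms by auto

lemma out_degree_mat_digraph:
  assumes "dim_row M = n" "u < n"
  shows "out_degree (mat_digraph M) u = card {j. j < n \<and> M $$ (u, j) = 1}"
proof -
  have "out_arcs (mat_digraph M) u = Pair u ` {j. j < n \<and> M $$ (u, j) = 1}"
    using assms by (auto simp: mat_digraph_def)
  then show ?thesis by (simp add: out_degree_def card_image inj_on_def)
qed

lemma excess_out_degree:
  assumes "tournament_mat n M" "u < n"
  shows "excess M {..<n} u = of_int (2 * int (out_degree (mat_digraph M) u) - (int n - 1))"
  using excess_eq_card[OF assms(1) subset_refl, of u] assms(2) tournament_matD(2)[OF assms(1)]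
  by (simp add: out_degree_mat_digraph)

section \<open>Balanced tournaments in terms of excesses\<close>

text \<open>Two excesses differ by twice the difference of the outdegrees, and their mean is 0.
  Outdegrees within 1 of each other therefore keep each excess strictly below 2 in absolute value,
  and integrality lowers this to 1. Conversely, excesses in \<open>[-1, 1]\<close> differ by at most
  2.\<close>

lemma regular_or_almost_regular_iff:
  assumes T: "tournament_mat m N" and m: "m > 0"
  shows "regular_tournament m N \<or> almost_regular_tournament m N \<longleftrightarrow>
    (\<forall>u<m. \<bar>excess N {..<m} u\<bar> \<le> 1)"
proof -
  define d where "d u = int (out_degree (mat_digraph N) u)" for u
  define S where "S = {\<bar>d u - d v\<bar> | u v. u < m \<and> v < m}"
  have ex: "excess N {..<m} u = of_int (2 * d u - (int m - 1))" if "u < m" for u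
    using excess_out_degree[OF T that] by (simp add: d_def)
  have "S = (\<lambda>(u, v). \<bar>d u - d v\<bar>) ` ({..<m} \<times> {..<m})" by (auto simp: S_def)
  then have finS: "finite S" by simp
  have ar: "almost_regular_tournament m N \<longleftrightarrow> Max S = 1"
    using T by (simp add: almost_regular_tournament_def S_def d_def)
  have r: "regular_tournament m N \<longleftrightarrow> (\<forall>u<m. \<forall>v<m. d u = d v)"
    using T by (simp add: regular_tournament_def d_def)
  show ?thesis
  proof (intro iffI allI impI)
    fix u assume reg: "regular_tournament m N \<or> almost_regular_tournament m N" and u: "u < m"
    have diff: "\<bar>d u - d v\<bar> \<le> 1" if "v < m" for v
      using reg
    proof
      assume "almost_regular_tournament m N"
      moreover have "\<bar>d u - d v\<bar> \<in> S" using u that by (auto simp: S_def)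
      ultimately show ?thesis using Max_ge[OF finS] by (metis ar)
    next
      assume "regular_tournament m N"
      then have "d u = d v" using r u that by blast
      then show ?thesis by simp
    qed
    \<comment> \<open>The excesses sum to 0, so subtracting them changes nothing. The term
      \<open>v = u\<close> vanishes, and having only \<open>m - 1\<close> terms of size at most 2
      makes the bound strict.\<close>
    have "real m * excess N {..<m} u = (\<Sum>v<m. excess N {..<m} u - excess N {..<m} v)"
      by (simp add: sum_subtractf sum_excess)
    also have "\<dots> = (\<Sum>v\<in>{..<m} - {u}. excess N {..<m} u - excess N {..<m} v)"
      using u by (intro sum.mono_neutral_right) auto
    also have "\<bar>\<dots>\<bar> \<le> (\<Sum>v\<in>{..<m} - {u}. 2)"
    proof (rule order_trans[OF sum_abs], rule sum_mono)
      fix v assume v: "v \<in> {..<m} - {u}"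
      have "\<bar>2 * d u - 2 * d v\<bar> \<le> 2" using diff[of v] v by auto
      then have "\<bar>real_of_int (2 * d u - 2 * d v)\<bar> \<le> 2" by linarith
      then show "\<bar>excess N {..<m} u - excess N {..<m} v\<bar> \<le> 2" using u v by (simp add: ex)
    qed
    also have "\<dots> < real m * 2" using u by (simp add: of_nat_diff)
    finally have "\<bar>excess N {..<m} u\<bar> < 2" using m by (simp add: abs_mult)
    then have "\<bar>2 * d u - (int m - 1)\<bar> < 2" unfolding ex[OF u] by linarith
    then have "\<bar>2 * d u - (int m - 1)\<bar> \<le> 1" by linarith
    then show "\<bar>excess N {..<m} u\<bar> \<le> 1" unfolding ex[OF u] by linarith
  next
    assume bd: "\<forall>u<m. \<bar>excess N {..<m} u\<bar> \<le> 1"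
    have diff: "\<bar>d u - d v\<bar> \<le> 1" if "u < m" "v < m" for u v
      using bd[rule_format, OF that(1)] bd[rule_format, OF that(2)] that by (simp add: ex)
    show "regular_tournament m N \<or> almost_regular_tournament m N"
    proof (cases "\<forall>u<m. \<forall>v<m. d u = d v")
      case False
      then obtain u v where uv: "u < m" "v < m" "d u \<noteq> d v" by blast
      then have "\<bar>d u - d v\<bar> = 1" using diff[of u v] by linarith
      moreover have "\<bar>d u - d v\<bar> \<in> S" using uv unfolding S_def by blast
      ultimately have "1 \<in> S" by simp
      moreover have "\<And>s. s \<in> S \<Longrightarrow> s \<le> 1" using diff by (auto simp: S_def)
      ultimately have "Max S = 1" using finS by (intro Max_eqI) auto
      then show ?thesis using ar by simp
    qed (use r in blast)
  qed
qed

section \<open>Lower bound from singularity\<close>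

text \<open>If \<open>M x = 0\<close>, then \<open>M + M\<^sup>T = J - I\<close> turns the transpose
  applied to \<open>x\<close> into \<open>\<sigma> - x i\<close> in each coordinate. Pairing this
  with \<open>x\<close> yields the norm of \<open>x\<close>, and pairing it with the all-ones vector
  yields the inner product with the excesses.\<close>

lemma sum_excess_squares_singular:
  assumes T: "tournament_mat n M" and det: "det M = 0"
  shows "real n * (real n - 1) \<le> (\<Sum>u<n. (excess M {..<n} u)\<^sup>2)"
proof -
  note TD = tournament_matD[OF T]
  obtain w where w: "w \<in> carrier_vec n" "w \<noteq> 0\<^sub>v n" "M *\<^sub>v w = 0\<^sub>v n"
    using det det_0_iff_vec_prod_zero_field[OF TD(1)] by auto
  define x where "x i = w $ i" for i
  define \<sigma> where "\<sigma> = (\<Sum>i<n. x i)"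
  have row: "(\<Sum>j<n. M $$ (i, j) * x j) = 0" if "i < n" for i
  proof -
    have "(M *\<^sub>v w) $ i = (\<Sum>j<n. M $$ (i, j) * x j)"
      using that TD(1) w(1) by (auto simp: scalar_prod_def x_def lessThan_atLeast0)
    then show ?thesis using w(3) that by simp
  qed
  have col: "(\<Sum>j<n. M $$ (j, i) * x j) = \<sigma> - x i" if i: "i < n" for i
  proof -
    have "(\<Sum>j<n. (M $$ (i, j) + M $$ (j, i)) * x j) = (\<Sum>j<n. x j - (if i = j then x j else 0))"
      using TD(4,5) i by (intro sum.cong) auto
    then show ?thesis
      using row[OF i] i by (simp add: distrib_right sum.distrib sum_subtractf \<sigma>_def)
  qed
  \<comment> \<open>The quadratic form of \<open>M\<close> at \<open>x\<close> is evaluated through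
    columns and then through rows, where it vanishes.\<close>
  have "(\<Sum>i<n. x i * (\<sigma> - x i)) = (\<Sum>i<n. x i * (\<Sum>j<n. M $$ (j, i) * x j))"
    using col by (intro sum.cong) auto
  also have "\<dots> = (\<Sum>j<n. x j * (\<Sum>i<n. M $$ (j, i) * x i))"
    unfolding sum_distrib_left by (subst sum.swap) (simp add: mult_ac)
  also have "\<dots> = 0" using row by simp
  finally have sq: "(\<Sum>i<n. (x i)\<^sup>2) = \<sigma>\<^sup>2"
    by (simp add: right_diff_distrib sum_subtractf sum_distrib_right[symmetric] \<sigma>_def
        power2_eq_square)
  have "\<sigma> \<noteq> 0"
  proof
    assume "\<sigma> = 0"
    then have "\<forall>i\<in>{..<n}. (x i)\<^sup>2 = 0" using sq by (subst sum_nonneg_eq_0_iff[symmetric]) auto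
    then have "w = 0\<^sub>v n" using w(1) by (intro eq_vecI) (auto simp: x_def)
    then show False using w(2) by simp
  qed
  define y where "y i = x i / \<sigma>" for i
  have y1: "(\<Sum>i<n. y i) = 1"
    using \<open>\<sigma> \<noteq> 0\<close> by (simp add: y_def sum_divide_distrib[symmetric] \<sigma>_def)
  have y2: "(\<Sum>i<n. (y i)\<^sup>2) = 1"
    using \<open>\<sigma> \<noteq> 0\<close> sq by (simp add: y_def power_divide sum_divide_distrib[symmetric])
  have "(\<Sum>i<n. excess M {..<n} i * x i)
      = (\<Sum>i<n. \<Sum>j<n. M $$ (i, j) * x i) - (\<Sum>i<n. \<Sum>j<n. M $$ (j, i) * x i)"
    unfolding excess_def sum_distrib_right by (simp add: left_diff_distrib sum_subtractf)
  also have "(\<Sum>i<n. \<Sum>j<n. M $$ (j, i) * x i) = 0"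
    by (subst sum.swap) (simp add: row)
  also have "(\<Sum>i<n. \<Sum>j<n. M $$ (i, j) * x i) = (\<Sum>i<n. \<sigma> - x i)"
    by (subst sum.swap) (simp add: col)
  also have "\<dots> = (real n - 1) * \<sigma>"
    by (simp add: sum_subtractf \<sigma>_def[symmetric] left_diff_distrib)
  finally have ey: "(\<Sum>i<n. excess M {..<n} i * y i) = real n - 1"
    using \<open>\<sigma> \<noteq> 0\<close> by (simp add: y_def sum_divide_distrib[symmetric])
  \<comment> \<open>Cauchy--Schwarz for \<open>e\<close> and the component of \<open>y\<close> orthogonal to the all-ones vector.\<close>
  have "0 \<le> (\<Sum>i<n. (excess M {..<n} i - real n * y i + 1)\<^sup>2)"
    by (intro sum_nonneg) auto
  also have "\<dots> = (\<Sum>i<n. (excess M {..<n} i)\<^sup>2 + (real n)\<^sup>2 * (y i)\<^sup>2 + 1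
      - 2 * real n * (excess M {..<n} i * y i) + 2 * excess M {..<n} i - 2 * real n * y i)"
    by (intro sum.cong) (auto simp: power2_eq_square algebra_simps)
  also have "\<dots> = (\<Sum>i<n. (excess M {..<n} i)\<^sup>2) + (real n)\<^sup>2 + real n
      - 2 * real n * (real n - 1) - 2 * real n"
    by (simp add: sum.distrib sum_subtractf sum_distrib_left[symmetric] y1 y2 ey sum_excess)
  finally show ?thesis by (simp add: power2_eq_square algebra_simps)
qed

section \<open>Counting 3-cycles through excesses\<close>

text \<open>A cyclic 3-set comes from exactly the three rotations of one ordered triple, since arcs
  are asymmetric. Ordered triples can then be counted by products of matrix entries.\<close>

lemma three_C3:
  assumes T: "tournament_mat n M"
  shows "3 * C3 M = card {(i, j, k). i < n \<and> j < n \<and> k < n \<and>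
    M $$ (i, j) = 1 \<and> M $$ (j, k) = 1 \<and> M $$ (k, i) = 1}" (is "_ = card ?X")
proof -
  note TD = tournament_matD[OF T]
  define f :: "nat \<times> nat \<times> nat \<Rightarrow> nat set" where "f = (\<lambda>(i, j, k). {i, j, k})"
  define Y where "Y = {S. S \<subseteq> {..<n} \<and> card S = 3 \<and>
     (\<exists>i j k. S = {i, j, k} \<and> M $$ (i, j) = 1 \<and> M $$ (j, k) = 1 \<and> M $$ (k, i) = 1)}"
  have asym: "M $$ (j, i) \<noteq> 1" if "M $$ (i, j) = 1" "i < n" "j < n" for i j
    using TD(4)[of i] TD(5)[of i j] that by (cases "i = j") auto
  have finX: "finite ?X"
    by (rule finite_subset[of _ "{..<n} \<times> {..<n} \<times> {..<n}"]) auto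
  have finY: "finite Y" by (rule finite_subset[of _ "Pow {..<n}"]) (auto simp: Y_def)
  have fXY: "f ` ?X \<subseteq> Y"
  proof clarify
    fix i j k assume a: "i < n" "j < n" "k < n" "M $$ (i, j) = 1" "M $$ (j, k) = 1" "M $$ (k, i) = 1"
    then have "i \<noteq> j" "j \<noteq> k" "i \<noteq> k" using asym by metis+
    then show "f (i, j, k) \<in> Y" using a by (auto simp: Y_def f_def)
  qed
  have fibre: "card {p \<in> ?X. f p = S} = 3" if SY: "S \<in> Y" for S
  proof -
    obtain i j k where S: "S = {i, j, k}" "card S = 3"
      and arcs: "M $$ (i, j) = 1" "M $$ (j, k) = 1" "M $$ (k, i) = 1"
      using SY unfolding Y_def by blast
    moreover have "S \<subseteq> {..<n}" using SY unfolding Y_def by blast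
    ultimately have a: "i < n" "j < n" "k < n" "M $$ (i, j) = 1" "M $$ (j, k) = 1" "M $$ (k, i) = 1"
      by auto
    have d: "i \<noteq> j" "j \<noteq> k" "i \<noteq> k" using a asym by metis+
    have no: "M $$ (j, i) \<noteq> 1" "M $$ (k, j) \<noteq> 1" "M $$ (i, k) \<noteq> 1"
      "M $$ (i, i) \<noteq> 1" "M $$ (j, j) \<noteq> 1" "M $$ (k, k) \<noteq> 1" using a asym by metis+
    have "{p \<in> ?X. f p = S} = {(i, j, k), (j, k, i), (k, i, j)}"
    proof (intro equalityI subsetI)
      fix p assume p: "p \<in> {p \<in> ?X. f p = S}"
      obtain u v w where pe: "p = (u, v, w)" by (cases p)
      have "u \<in> {i, j, k}" "v \<in> {i, j, k}" "w \<in> {i, j, k}"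
        using p by (auto simp: pe f_def S(1))
      then show "p \<in> {(i, j, k), (j, k, i), (k, i, j)}"
        using p no by (auto simp: pe)
    qed (use a in \<open>auto simp: f_def S(1)\<close>)
    then show ?thesis using d by simp
  qed
  have "card ?X = (\<Sum>S\<in>Y. card {p \<in> ?X. f p = S})"
    using sum.group[OF finX finY fXY, of "\<lambda>_. 1 :: nat"] by simp
  also have "\<dots> = 3 * card Y" using fibre by simp
  finally show ?thesis by (simp add: C3_def Y_def TD(2))
qed

text \<open>Closed walks of length 3 are two-step walks minus transitive triples, and both of these
  counts depend only on the outdegrees \<open>s i\<close>.\<close>

lemma C3_excess:
  assumes T: "tournament_mat n M"
  shows "24 * real (C3 M) + 3 * (\<Sum>u<n. (excess M {..<n} u)\<^sup>2) = real n ^ 3 - real n"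
proof -
  note TD = tournament_matD[OF T]
  let ?X = "{(i, j, k). i < n \<and> j < n \<and> k < n \<and>
    M $$ (i, j) = 1 \<and> M $$ (j, k) = 1 \<and> M $$ (k, i) = 1}"
  define m where "m i j = M $$ (i, j)" for i j
  define s where "s i = (\<Sum>j<n. m i j)" for i
  define c where "c = real n - 1"
  have m0: "m i i = 0" if "i < n" for i using TD(4) that by (simp add: m_def)
  have msum: "m i j + m j i = (if i = j then 0 else 1)" if "i < n" "j < n" for i j
    using TD(4,5) that by (simp add: m_def)
  have mprod: "m i j * m j i = 0" and msq: "m i j * m i j = m i j" if "i < n" "j < n" for i j
    using TD(3)[OF that] TD(3)[OF that(2,1)] TD(5)[OF that] TD(4)[OF that(1)]
    by (cases "i = j"; auto simp: m_def)+
  have ex: "excess M {..<n} i = 2 * s i - c" if "i < n" for i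
    using excess_eq_sum[OF T subset_refl, of i] that by (simp add: s_def m_def c_def)
  have incol: "(\<Sum>j<n. m j i) = c - s i" if "i < n" for i
    using ex[OF that] unfolding excess_def by (simp add: sum_subtractf s_def m_def)
  have "real (card ?X) = (\<Sum>p\<in>{..<n} \<times> {..<n} \<times> {..<n}. if p \<in> ?X then 1 else 0)"
    by (simp add: sum.If_cases) (rule arg_cong[of _ _ card], auto)
  also have "\<dots> = (\<Sum>(i, j, k)\<in>{..<n} \<times> {..<n} \<times> {..<n}. m i j * m j k * m k i)"
  proof (intro sum.cong refl)
    fix p assume "p \<in> {..<n} \<times> {..<n} \<times> {..<n}"
    then obtain i j k where p: "p = (i, j, k)" "i < n" "j < n" "k < n" by auto
    show "(if p \<in> ?X then 1 else 0) = (case p of (i, j, k) \<Rightarrow> m i j * m j k * m k i)"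
      using TD(3)[of i j] TD(3)[of j k] TD(3)[of k i] p by (auto simp: m_def)
  qed
  also have "\<dots> = (\<Sum>i<n. \<Sum>j<n. \<Sum>k<n. m i j * m j k * m k i)"
    by (simp add: sum.cartesian_product)
  \<comment> \<open>Replace \<open>m k i\<close> by \<open>1 - m i k\<close>. For
    \<open>i = k\<close> both sides are 0 because \<open>m i j * m j i = 0\<close>.\<close>
  also have "\<dots> = (\<Sum>i<n. \<Sum>j<n. \<Sum>k<n. m i j * m j k - m i j * m i k * m j k)"
  proof (intro sum.cong refl)
    fix i j k assume "i \<in> {..<n}" "j \<in> {..<n}" "k \<in> {..<n}"
    then have "m k i = 1 - m i k - (if i = k then 1 else 0)" and "m i j * m j i = 0"
      using msum[of i k] mprod[of i j] by auto
    then show "m i j * m j k * m k i = m i j * m j k - m i j * m i k * m j k"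
      by (cases "i = k") (simp_all add: right_diff_distrib mult_ac)
  qed
  also have "\<dots> = (\<Sum>i<n. \<Sum>j<n. \<Sum>k<n. m i j * m j k)
      - (\<Sum>i<n. \<Sum>j<n. \<Sum>k<n. m i j * m i k * m j k)"
    by (simp add: sum_subtractf)
  \<comment> \<open>Two-step walks are counted by their midpoint, as indegree times
    outdegree.\<close>
  also have "(\<Sum>i<n. \<Sum>j<n. \<Sum>k<n. m i j * m j k) = (\<Sum>j<n. (c - s j) * s j)"
  proof -
    have "(\<Sum>i<n. \<Sum>j<n. \<Sum>k<n. m i j * m j k) = (\<Sum>i<n. \<Sum>j<n. m i j * s j)"
      by (simp add: s_def sum_distrib_left)
    also have "\<dots> = (\<Sum>j<n. \<Sum>i<n. m i j * s j)" by (rule sum.swap)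
    also have "\<dots> = (\<Sum>j<n. (c - s j) * s j)"
      by (simp add: sum_distrib_right[symmetric] incol)
    finally show ?thesis .
  qed
  \<comment> \<open>Transitive triples are counted by their source \<open>i\<close>: each pair of
    out-neighbours of \<open>i\<close> is joined by exactly one arc.\<close>
  also have "(\<Sum>i<n. \<Sum>j<n. \<Sum>k<n. m i j * m i k * m j k) = (\<Sum>i<n. ((s i)\<^sup>2 - s i) / 2)"
  proof (rule sum.cong[OF refl])
    fix i assume i: "i \<in> {..<n}"
    let ?t = "\<Sum>j<n. \<Sum>k<n. m i j * m i k * m j k"
    have "?t = (\<Sum>j<n. \<Sum>k<n. m i j * m i k * m k j)"
      by (subst sum.swap) (simp add: mult_ac)
    then have "2 * ?t = (\<Sum>j<n. \<Sum>k<n. m i j * m i k * (m j k + m k j))"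
      by (simp add: distrib_left sum.distrib)
    also have "\<dots> = (\<Sum>j<n. \<Sum>k<n. m i j * m i k - (if j = k then m i j else 0))"
      using i by (intro sum.cong refl) (auto simp: msum msq)
    also have "\<dots> = (s i)\<^sup>2 - s i"
      by (simp add: sum_subtractf s_def power2_eq_square sum_product)
    finally show "?t = ((s i)\<^sup>2 - s i) / 2" by simp
  qed
  finally have X: "real (card ?X) = (\<Sum>i<n. (c - s i) * s i) - (\<Sum>i<n. ((s i)\<^sup>2 - s i) / 2)" .
  have "8 * real (card ?X) = (\<Sum>i<n. 8 * ((c - s i) * s i) - 4 * ((s i)\<^sup>2 - s i))"
    unfolding X right_diff_distrib sum_distrib_left sum_subtractf[symmetric]
    by (intro sum.cong) (auto simp: field_simps)
  \<comment> \<open>Substitute \<open>s i = (e + c) / 2\<close>, where \<open>e\<close> is the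
    excess of \<open>i\<close>. The term linear in \<open>e\<close> disappears on summation.\<close>
  also have "\<dots> = (\<Sum>i<n. c * (c + 2) - 3 * (excess M {..<n} i)\<^sup>2
      + (2 - 2 * c) * excess M {..<n} i)"
    by (intro sum.cong refl) (simp add: ex power2_eq_square algebra_simps)
  also have "\<dots> = real n * (c * (c + 2)) - 3 * (\<Sum>i<n. (excess M {..<n} i)\<^sup>2)"
    by (simp add: sum.distrib sum_subtractf sum_distrib_left[symmetric] sum_excess)
  also have "real n * (c * (c + 2)) = real n ^ 3 - real n"
    by (simp add: c_def power3_eq_cube algebra_simps)
  finally show ?thesis using three_C3[OF T] by linarith
qed

section \<open>Strong connectivity by cuts\<close>

text \<open>A walk cannot leave a set without outgoing arcs. Conversely, the set of vertices
  reachable from \<open>u\<close> has no outgoing arcs, so it must contain every vertex.\<close>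

lemma strongly_connected_mat_digraph_iff:
  assumes "dim_row M = n" "n > 0"
  shows "strongly_connected (mat_digraph M) \<longleftrightarrow>
    (\<forall>B. B \<subseteq> {..<n} \<and> B \<noteq> {} \<and> B \<noteq> {..<n} \<longrightarrow> (\<exists>i\<in>B. \<exists>j\<in>{..<n} - B. M $$ (i, j) = 1))"
    (is "_ \<longleftrightarrow> ?R")
proof -
  let ?G = "with_proj (mat_digraph M)"
  interpret wf_digraph ?G
    by unfold_locales (auto simp: mat_digraph_def)
  have V: "verts ?G = {..<n}" using assms by (simp add: mat_digraph_def)
  have adj: "i \<rightarrow>\<^bsub>?G\<^esub> j \<longleftrightarrow> i < n \<and> j < n \<and> M $$ (i, j) = 1" for i j
    using assms by (auto simp: mat_digraph_def)
  show ?thesis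
  proof
    assume sc: "strongly_connected ?G"
    show ?R
    proof (intro allI impI, rule ccontr)
      fix B assume B: "B \<subseteq> {..<n} \<and> B \<noteq> {} \<and> B \<noteq> {..<n}"
        and no: "\<not> (\<exists>i\<in>B. \<exists>j\<in>{..<n} - B. M $$ (i, j) = 1)"
      then obtain u v where uv: "u \<in> B" "v \<in> {..<n} - B" by blast
      then have "u \<rightarrow>\<^sup>*\<^bsub>?G\<^esub> v" using sc B V by (auto simp: strongly_connected_def)
      then have "v \<in> B"
        by (induction rule: reachable_induct) (use uv no adj in auto)
      then show False using uv by simp
    qed
  next
    assume R: ?R
    show "strongly_connected ?G"
    proof (unfold strongly_connected_def V, intro conjI ballI)
      show "{..<n} \<noteq> {}" using assms by auto
    next
      fix u v assume uv: "u \<in> {..<n}" "v \<in> {..<n}"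
      let ?B = "{w. u \<rightarrow>\<^sup>*\<^bsub>?G\<^esub> w}"
      have "?B \<subseteq> {..<n}" using reachable_in_verts V by auto
      moreover have "u \<in> ?B" using uv V by auto
      moreover have "\<not> (\<exists>i\<in>?B. \<exists>j\<in>{..<n} - ?B. M $$ (i, j) = 1)"
      proof
        assume "\<exists>i\<in>?B. \<exists>j\<in>{..<n} - ?B. M $$ (i, j) = 1"
        then obtain i j where ij: "u \<rightarrow>\<^sup>*\<^bsub>?G\<^esub> i" "j < n" "\<not> u \<rightarrow>\<^sup>*\<^bsub>?G\<^esub> j" "M $$ (i, j) = 1"
          by blast
        have "i < n" using reachable_in_verts(2)[OF ij(1)] V by simp
        then have "u \<rightarrow>\<^sup>*\<^bsub>?G\<^esub> j" using reachable_adj_trans[OF ij(1)] adj ij(2,4) by blast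
        then show False using ij(3) by contradiction
      qed
      ultimately have "?B = {..<n}" using R by blast
      then show "u \<rightarrow>\<^sup>*\<^bsub>?G\<^esub> v" using uv by auto
    qed
  qed
qed

section \<open>Deleting a vertex\<close>

lemma bij_betw_insert_index:
  assumes "v < n"
  shows "bij_betw (insert_index v) {..<n - 1} ({..<n} - {v})"
proof (rule bij_betw_byWitness[where f' = "delete_index v"])
  show "\<forall>a'\<in>{..<n} - {v}. insert_index v (delete_index v a') = a'"
    by (auto intro: insert_delete_index)
qed (use assms in \<open>auto simp: insert_index_def delete_index_def\<close>)

lemma mat_delete_insert_index:
  assumes "M \<in> carrier_mat n n" "v < n" "i < n - 1" "j < n - 1"
  shows "mat_delete M v v $$ (i, j) = M $$ (insert_index v i, insert_index v j)"
  using assms by (auto simp: mat_delete_def insert_index_def)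

lemma tournament_mat_delete:
  assumes T: "tournament_mat n M" and v: "v < n"
  shows "tournament_mat (n - 1) (mat_delete M v v)"
proof -
  note TD = tournament_matD[OF T]
  have "insert_index v i < n" if "i < n - 1" for i
    using that by (auto simp: insert_index_def)
  moreover have "insert_index v i \<noteq> insert_index v j" if "i \<noteq> j" for i j
    using that delete_insert_index by metis
  ultimately show ?thesis
    unfolding tournament_mat_iff
    using TD(3-5) mat_delete_carrier[OF TD(1)] mat_delete_insert_index[OF TD(1) v] by auto
qed

lemma excess_mat_delete:
  assumes T: "tournament_mat n M" and v: "v < n" and u: "u < n - 1"
  shows "excess (mat_delete M v v) {..<n - 1} u = excess M ({..<n} - {v}) (insert_index v u)"
  unfolding excess_def
  by (subst sum.reindex_bij_betw[OF bij_betw_insert_index[OF v], symmetric])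
    (use mat_delete_insert_index[OF tournament_matD(1)[OF T] v] u in simp)

text \<open>Undoes the renumbering of vertices in \<open>mat_delete\<close>: balance of the smaller
  tournament is read off from excesses of \<open>M\<close> on the remaining vertices.\<close>

lemma regular_or_almost_regular_delete_iff:
  assumes T: "tournament_mat n M" and v: "v < n" and n: "n \<ge> 2"
  shows "regular_tournament (n - 1) (mat_delete M v v) \<or>
      almost_regular_tournament (n - 1) (mat_delete M v v) \<longleftrightarrow>
    (\<forall>u\<in>{..<n} - {v}. \<bar>excess M ({..<n} - {v}) u\<bar> \<le> 1)"
proof -
  have "{..<n} - {v} = insert_index v ` {..<n - 1}"
    using bij_betw_insert_index[OF v] by (simp add: bij_betw_def)
  then have "(\<forall>u\<in>{..<n} - {v}. \<bar>excess M ({..<n} - {v}) u\<bar> \<le> 1) \<longleftrightarrow>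
      (\<forall>u<n - 1. \<bar>excess M ({..<n} - {v}) (insert_index v u)\<bar> \<le> 1)"
    by auto
  also have "\<dots> \<longleftrightarrow> (\<forall>u<n - 1. \<bar>excess (mat_delete M v v) {..<n - 1} u\<bar> \<le> 1)"
    using excess_mat_delete[OF T v] by simp
  finally show ?thesis
    using regular_or_almost_regular_iff[OF tournament_mat_delete[OF T v]] n by simp
qed

section \<open>Trivial maximizers are not strongly connected\<close>

text \<open>Strong connectivity would limit the excess of \<open>v\<close> to \<open>n - 3\<close>
  and the others to 2. The sum of squares is then at most
  \<open>(n - 3)\<^sup>2 + 4 (n - 1) = n\<^sup>2 - 2 n + 5\<close>, which is below
  \<open>n (n - 1)\<close> once \<open>n > 5\<close>.\<close>

lemma trivial_imp_not_strongly_connected: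
  assumes n: "n \<ge> 6" and T: "tournament_mat n M" and det: "det M = 0" and v: "v < n"
    and N: "regular_tournament (n - 1) (mat_delete M v v) \<or>
      almost_regular_tournament (n - 1) (mat_delete M v v)"
  shows "\<not> strongly_connected (mat_digraph M)"
proof
  assume sc: "strongly_connected (mat_digraph M)"
  note TD = tournament_matD[OF T]
  define K where "K i j = M $$ (i, j) - M $$ (j, i)" for i j
  have K1: "\<bar>K i j\<bar> \<le> 1" if "i < n" "j < n" for i j
    using TD(3)[OF that] TD(3)[OF that(2,1)] by (auto simp: K_def)
  have cut: "\<exists>i\<in>B. \<exists>j\<in>{..<n} - B. M $$ (i, j) = 1"
    if "B \<subseteq> {..<n}" "B \<noteq> {}" "B \<noteq> {..<n}" for B
    using sc strongly_connected_mat_digraph_iff[OF TD(2)] n that by auto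
  have ne: "{..<n} \<noteq> {v}"
  proof
    assume "{..<n} = {v}"
    then have "card {..<n} = card {v}" by (rule arg_cong)
    then show False using n by simp
  qed
  obtain p where p: "p < n" "p \<noteq> v" "M $$ (v, p) = 1"
    using cut[of "{v}"] v ne by auto
  have "{..<n} - {v} \<noteq> {}" "{..<n} - {v} \<noteq> {..<n}" using v ne by auto
  from cut[OF Diff_subset this] v obtain q where q: "q < n" "q \<noteq> v" "M $$ (q, v) = 1"
    by auto
  have Kp: "K v p = 1" using TD(5)[OF v p(1)] p by (auto simp: K_def)
  have Kq: "K v q = -1" using TD(5)[OF v q(1)] q by (auto simp: K_def)
  have pq: "p \<noteq> q" using Kp Kq by auto
  \<comment> \<open>The out-neighbour \<open>p\<close> and the in-neighbour \<open>q\<close> cancel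
    and \<open>v\<close> itself contributes 0, so only \<open>n - 3\<close> vertices can contribute
    to the excess of \<open>v\<close>.\<close>
  let ?A = "{..<n} - {v, p, q}"
  have "{..<n} - (?A) = {v, p, q}" using v p q by auto
  then have "sum (K v) {..<n} = sum (K v) ?A + sum (K v) {v, p, q}"
    by (metis Diff_subset add.commute finite_lessThan sum.subset_diff)
  moreover have "sum (K v) {v, p, q} = 0" using p q pq Kp Kq by (simp add: K_def)
  moreover have "\<bar>sum (K v) ?A\<bar> \<le> (\<Sum>j\<in>?A. 1)"
    using K1 v by (intro order_trans[OF sum_abs] sum_mono) auto
  moreover have "card ?A = n - 3"
    using v p q pq by (subst card_Diff_subset) auto
  ultimately have "\<bar>excess M {..<n} v\<bar> \<le> real n - 3"
    using n by (simp add: excess_def K_def)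
  then have ev: "(excess M {..<n} v)\<^sup>2 \<le> (real n - 3)\<^sup>2"
    by (rule abs_le_square_iff[THEN iffD1, OF order_trans]) simp
  have eu: "(excess M {..<n} u)\<^sup>2 \<le> 4" if u: "u \<in> {..<n} - {v}" for u
  proof -
    have "excess M {..<n} u = K u v + excess M ({..<n} - {v}) u"
      unfolding excess_def K_def using v by (subst sum.remove[of _ v]) auto
    moreover have "\<bar>excess M ({..<n} - {v}) u\<bar> \<le> 1"
      using regular_or_almost_regular_delete_iff[OF T v] n N u by auto
    ultimately have "\<bar>excess M {..<n} u\<bar> \<le> 2" using K1[of u v] u v by auto
    then have "(excess M {..<n} u)\<^sup>2 \<le> 2\<^sup>2" by (subst abs_le_square_iff[symmetric]) simp
    then show ?thesis by simp
  qed
  have "real n * (real n - 1) \<le> (\<Sum>u<n. (excess M {..<n} u)\<^sup>2)"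
    by (rule sum_excess_squares_singular[OF T det])
  also have "\<dots> = (excess M {..<n} v)\<^sup>2 + (\<Sum>u\<in>{..<n} - {v}. (excess M {..<n} u)\<^sup>2)"
    using v by (subst sum.remove[of _ v]) auto
  also have "\<dots> \<le> (real n - 3)\<^sup>2 + (\<Sum>u\<in>{..<n} - {v}. 4)"
    using ev eu by (intro add_mono sum_mono) auto
  also have "\<dots> = (real n - 3)\<^sup>2 + 4 * (real n - 1)"
    using v by (simp add: of_nat_diff)
  finally have "real n \<le> 5" by (simp add: power2_eq_square algebra_simps)
  then show False using n by simp
qed

section \<open>A singular comparison tournament\<close>

text \<open>Vertex \<open>n - 1\<close> is a sink, so its row is zero and the matrix is singular.
  Among the other vertices the smaller index wins exactly when the parities differ. This one rule is
  regular when their number is odd and almost regular when it is even and positive.\<close>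

definition parity_sink :: "nat \<Rightarrow> real mat" where
  "parity_sink n = mat n n (\<lambda>(i, j). of_bool (i < n - 1 \<and>
     (j = n - 1 \<or> (i < j \<and> odd (i + j)) \<or> (j < i \<and> even (i + j)))))"

lemma tournament_parity_sink: "tournament_mat n (parity_sink n)"
  unfolding tournament_mat_iff by (auto simp: parity_sink_def add.commute)

lemma det_parity_sink:
  assumes "n > 0"
  shows "det (parity_sink n) = 0"
proof -
  have c: "parity_sink n \<in> carrier_mat n n" by (simp add: parity_sink_def)
  have "det (parity_sink n) = (\<Sum>j<n. parity_sink n $$ (n - 1, j) * cofactor (parity_sink n) (n - 1) j)"
    using assms by (intro laplace_expansion_row[OF c]) auto
  also have "\<dots> = 0" using assms by (intro sum.neutral) (auto simp: parity_sink_def)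
  finally show ?thesis .
qed

lemma sum_alternating: "(\<Sum>j<i. (-1) ^ j) = (of_bool (odd i) :: real)"
  by (induction i) auto

text \<open>The arcs at \<open>i\<close> contribute alternating signs, with a sign flip on passing
  \<open>i\<close>. At order \<open>i + 1\<close> only a plain alternating sum is left, and each
  further vertex toggles the value between 0 and \<open>(-1) ^ i\<close>.\<close>

lemma excess_parity_sink:
  assumes "i < m"
  shows "excess (parity_sink (Suc m)) {..<m} i = (-1) ^ i * of_bool (even m)"
proof -
  let ?k = "\<lambda>j. if j < i then (-1) ^ (i + j) else if i < j then - ((-1) ^ (i + j)) else (0 :: real)"
  have "excess (parity_sink (Suc m)) {..<m} i = sum ?k {..<m}"
    unfolding excess_def using assms by (intro sum.cong) (auto simp: parity_sink_def)
  also have "sum ?k {..<m} = (-1) ^ i * of_bool (even m)"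
    using Suc_leI[OF assms]
  proof (induction m rule: dec_induct)
    case base
    have "sum ?k {..<Suc i} = (-1) ^ i * (\<Sum>j<i. (-1) ^ j)"
      by (simp add: power_add sum_distrib_left)
    then show ?case by (simp add: sum_alternating)
  next
    case (step m)
    then show ?case by (auto simp: power_add)
  qed
  finally show ?thesis .
qed

text \<open>The sink contributes \<open>m\<^sup>2\<close>. Every other excess is raised by 1, and
  since these excesses sum to 0 beforehand, this adds exactly \<open>m\<close> to their
  squares.\<close>

lemma sum_excess_squares_parity_sink:
  "(\<Sum>u<Suc m. (excess (parity_sink (Suc m)) {..<Suc m} u)\<^sup>2)
    = real m * (real m + 1) + real m * of_bool (even m)"
proof -
  let ?P = "parity_sink (Suc m)"
  have "excess ?P {..<Suc m} m = - real m"
    by (simp add: excess_def parity_sink_def)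
  moreover have "excess ?P {..<Suc m} u = 1 + excess ?P {..<m} u" if "u < m" for u
    using that by (simp add: excess_def parity_sink_def)
  moreover have "(\<Sum>u<m. (1 + excess ?P {..<m} u)\<^sup>2)
      = real m + real m * of_bool (even m)"
  proof -
    have "(\<Sum>u<m. (1 + excess ?P {..<m} u)\<^sup>2)
        = (\<Sum>u<m. 1 + 2 * excess ?P {..<m} u + (excess ?P {..<m} u)\<^sup>2)"
      by (simp add: power2_eq_square algebra_simps)
    also have "\<dots> = real m + (\<Sum>u<m. (excess ?P {..<m} u)\<^sup>2)"
      by (simp add: sum.distrib sum_distrib_left[symmetric] sum_excess)
    also have "(\<Sum>u<m. (excess ?P {..<m} u)\<^sup>2) = (\<Sum>u<m. of_bool (even m))"
      by (intro sum.cong) (auto simp: excess_parity_sink simp flip: power_mult)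
    finally show ?thesis by simp
  qed
  ultimately show ?thesis by (simp add: power2_eq_square algebra_simps)
qed

text \<open>By \<open>C3_excess\<close>, a maximizer has no larger sum of squares than
  \<open>parity_sink n\<close>. The extra term for odd \<open>n\<close> comes from the excesses
  \<plusminus>1 of a balanced tournament of even order \<open>n - 1\<close>.\<close>

lemma sum_excess_squares_maximizer:
  assumes n: "n > 0" and M: "singular_C3_maximizer n M"
  shows "(\<Sum>u<n. (excess M {..<n} u)\<^sup>2) \<le> real n * (real n - 1) + (real n - 1) * of_bool (odd n)"
proof -
  have T: "tournament_mat n M"
    using M by (simp add: singular_C3_maximizer_def singular_tournaments_def)
  have "parity_sink n \<in> singular_tournaments n"
    using tournament_parity_sink det_parity_sink[OF n] by (simp add: singular_tournaments_def)
  then have "C3 (parity_sink n) \<le> C3 M"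
    using M finite_singular_tournaments by (auto simp: singular_C3_maximizer_def)
  then have "(\<Sum>u<n. (excess M {..<n} u)\<^sup>2) \<le> (\<Sum>u<n. (excess (parity_sink n) {..<n} u)\<^sup>2)"
    using C3_excess[OF T] C3_excess[OF tournament_parity_sink, of n] by linarith
  also have "\<dots> = real n * (real n - 1) + (real n - 1) * of_bool (odd n)"
    using sum_excess_squares_parity_sink[of "n - 1"] n by (auto simp: of_nat_diff mult_ac)
  finally show ?thesis .
qed

section \<open>Maximizers that are not strongly connected\<close>

text \<open>Arcs across the cut raise the excesses in \<open>A\<close> by \<open>card B\<close> and
  lower those in \<open>B\<close> by \<open>card A\<close>. Inner excesses sum to 0 on each part, so
  no cross terms remain, and the shifts contribute \<open>a b\<^sup>2 + b a\<^sup>2 = a b n\<close>,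
  where \<open>a\<close> and \<open>b\<close> are the two cardinalities.\<close>

lemma sum_excess_squares_dominated:
  assumes T: "tournament_mat n M" and B: "B \<subseteq> {..<n}" and A: "A = {..<n} - B"
    and no: "\<And>i j. i \<in> B \<Longrightarrow> j \<in> A \<Longrightarrow> M $$ (i, j) \<noteq> 1"
  shows "(\<Sum>u<n. (excess M {..<n} u)\<^sup>2) = real (card A) * real (card B) * real n
    + (\<Sum>u\<in>A. (excess M A u)\<^sup>2) + (\<Sum>u\<in>B. (excess M B u)\<^sup>2)"
proof -
  note TD = tournament_matD[OF T]
  have fin: "finite A" "finite B" using A B finite_subset by blast+
  have un: "{..<n} = A \<union> B" "A \<inter> B = {}" using A B by auto
  have K: "M $$ (i, j) = 0" "M $$ (j, i) = 1" if "i \<in> B" "j \<in> A" for i j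
  proof -
    have "i < n" "j < n" "i \<noteq> j" using that A B by auto
    then show "M $$ (i, j) = 0" "M $$ (j, i) = 1" using no[OF that] TD(3)[of i j] TD(5)[of i j] by auto
  qed
  have split: "excess M {..<n} u = excess M A u + excess M B u" for u
    unfolding excess_def un(1) using fin un(2) by (rule sum.union_disjoint)
  have shift: "(\<Sum>u\<in>S. (c + excess M S u)\<^sup>2) = real (card S) * c\<^sup>2 + (\<Sum>u\<in>S. (excess M S u)\<^sup>2)"
    for c :: real and S
  proof -
    have "(\<Sum>u\<in>S. (c + excess M S u)\<^sup>2)
        = (\<Sum>u\<in>S. c\<^sup>2 + 2 * c * excess M S u + (excess M S u)\<^sup>2)"
      by (simp add: power2_eq_square algebra_simps)
    then show ?thesis by (simp add: sum.distrib sum_distrib_left[symmetric] sum_excess)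
  qed
  have "(\<Sum>u<n. (excess M {..<n} u)\<^sup>2)
      = (\<Sum>u\<in>A. (excess M A u + excess M B u)\<^sup>2) + (\<Sum>u\<in>B. (excess M A u + excess M B u)\<^sup>2)"
    unfolding split unfolding un(1) using fin un(2) by (rule sum.union_disjoint)
  also have "(\<Sum>u\<in>A. (excess M A u + excess M B u)\<^sup>2) = (\<Sum>u\<in>A. (real (card B) + excess M A u)\<^sup>2)"
  proof (rule sum.cong[OF refl])
    fix u assume "u \<in> A"
    then have "excess M B u = real (card B)" using K by (simp add: excess_def)
    then show "(excess M A u + excess M B u)\<^sup>2 = (real (card B) + excess M A u)\<^sup>2"
      by (simp add: add.commute)
  qed
  also have "(\<Sum>u\<in>B. (excess M A u + excess M B u)\<^sup>2) = (\<Sum>u\<in>B. (- real (card A) + excess M B u)\<^sup>2)"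
  proof (rule sum.cong[OF refl])
    fix u assume "u \<in> B"
    then have "excess M A u = - real (card A)" using K by (simp add: excess_def)
    then show "(excess M A u + excess M B u)\<^sup>2 = (- real (card A) + excess M B u)\<^sup>2" by simp
  qed
  also have "(\<Sum>u\<in>A. (real (card B) + excess M A u)\<^sup>2) + (\<Sum>u\<in>B. (- real (card A) + excess M B u)\<^sup>2)
      = real (card A) * real (card B) * (real (card A) + real (card B))
        + (\<Sum>u\<in>A. (excess M A u)\<^sup>2) + (\<Sum>u\<in>B. (excess M B u)\<^sup>2)"
    unfolding shift by (simp add: power2_eq_square algebra_simps)
  also have "real (card A) + real (card B) = real n"
    using card_Un_disjoint[OF fin un(2)] un(1) by (metis card_lessThan of_nat_add)
  finally show ?thesis .
qed

text \<open>The assumed bound is the least possible value. If \<open>card S\<close> is even, all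
  excesses are odd, so every square is at least 1 and no slack is left for \<open>u\<close>. If it
  is odd, the sum is 0.\<close>

lemma excess_le_one_of_sum_squares:
  assumes T: "tournament_mat n M" and S: "S \<subseteq> {..<n}"
    and le: "(\<Sum>u\<in>S. (excess M S u)\<^sup>2) \<le> real (card S) * of_bool (even (card S))"
    and u: "u \<in> S"
  shows "\<bar>excess M S u\<bar> \<le> 1"
proof -
  have fin: "finite S" using S finite_subset by blast
  have "(excess M S u)\<^sup>2 \<le> 1"
  proof (cases "even (card S)")
    case True
    have ge: "1 \<le> (excess M S w)\<^sup>2" if w: "w \<in> S" for w
    proof -
      define z where "z = 2 * int (card {j \<in> S. M $$ (w, j) = 1}) - (int (card S) - 1)"
      have "odd z" using True by (simp add: z_def)
      then have "z \<noteq> 0" by auto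
      then have "1 \<le> z\<^sup>2" by (simp add: int_one_le_iff_zero_less)
      then have "1 \<le> real_of_int (z\<^sup>2)" by linarith
      then show ?thesis unfolding excess_eq_card[OF T S w] z_def[symmetric] by simp
    qed
    have "(excess M S u)\<^sup>2 + real (card (S - {u})) \<le>
        (excess M S u)\<^sup>2 + (\<Sum>w\<in>S - {u}. (excess M S w)\<^sup>2)"
      using sum_mono[of "S - {u}" "\<lambda>_. 1" "\<lambda>w. (excess M S w)\<^sup>2"] ge by auto
    also have "\<dots> = (\<Sum>w\<in>S. (excess M S w)\<^sup>2)" using fin u by (simp add: sum.remove)
    also have "\<dots> \<le> real (card S)" using le True by simp
    also have "\<dots> = real (card (S - {u})) + 1" using fin u by (metis card.remove of_nat_Suc add.commute)
    finally show ?thesis by simp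
  next
    case False
    have "(excess M S u)\<^sup>2 \<le> (\<Sum>u\<in>S. (excess M S u)\<^sup>2)"
      using fin u by (intro member_le_sum) auto
    also have "\<dots> \<le> 0" using le False by simp
    finally show ?thesis by simp
  qed
  then show ?thesis using abs_le_square_iff[of "excess M S u" 1] by simp
qed

lemma not_strongly_connected_imp_trivial:
  assumes n: "n \<ge> 4" and M: "singular_C3_maximizer n M"
    and nsc: "\<not> strongly_connected (mat_digraph M)"
  shows "trivial_maximizer n M"
proof -
  have T: "tournament_mat n M"
    using M by (simp add: singular_C3_maximizer_def singular_tournaments_def)
  note TD = tournament_matD[OF T]
  obtain B where B: "B \<subseteq> {..<n}" "B \<noteq> {}" "B \<noteq> {..<n}"
    and no: "\<And>i j. i \<in> B \<Longrightarrow> j \<in> {..<n} - B \<Longrightarrow> M $$ (i, j) \<noteq> 1"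
    using nsc strongly_connected_mat_digraph_iff[OF TD(2)] n by (metis gr0I not_numeral_le_zero)
  define A where "A = {..<n} - B"
  define a b where "a = card A" and "b = card B"
  define DA DB where "DA = (\<Sum>u\<in>A. (excess M A u)\<^sup>2)" and "DB = (\<Sum>u\<in>B. (excess M B u)\<^sup>2)"
  have fin: "finite A" "finite B" using B(1) finite_subset by (auto simp: A_def)
  have "A \<noteq> {}" using B by (auto simp: A_def)
  then have pos: "a \<ge> 1" "b \<ge> 1" using fin B(2) by (simp_all add: a_def b_def card_gt_0_iff Suc_le_eq)
  have ab: "a + b = n"
    using card_Diff_subset[OF fin(2) B(1)] card_mono[OF _ B(1)]
    by (simp add: a_def b_def A_def)
  have nonneg: "DA \<ge> 0" "DB \<ge> 0" unfolding DA_def DB_def by (simp_all add: sum_nonneg)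
  have bound: "real a * real b * real n + DA + DB
      \<le> real n * (real n - 1) + (real n - 1) * of_bool (odd n)"
    using sum_excess_squares_maximizer[OF _ M] n
      sum_excess_squares_dominated[OF T B(1) A_def] no
    by (simp add: a_def b_def DA_def DB_def A_def)
  have "a = 1 \<or> b = 1"
  proof (rule ccontr)
    assume "\<not> (a = 1 \<or> b = 1)"
    \<comment> \<open>With \<open>a + b = n\<close> this says \<open>a b \<ge> 2 (n - 2)\<close>,
      which makes the cut term \<open>a b n\<close> too large for a maximizer as
      \<open>n \<ge> 4\<close>.\<close>
    then have "0 \<le> (real a - 2) * (real b - 2)" using pos by (intro mult_nonneg_nonneg) auto
    then have "2 * (real n - 2) \<le> real a * real b" using ab by (simp add: algebra_simps flip: ab)
    then have "2 * (real n - 2) * real n \<le> real a * real b * real n" by (intro mult_right_mono) auto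
    also have "\<dots> \<le> real n * (real n - 1) + (real n - 1)"
      using bound nonneg n by (cases "odd n") auto
    finally have "real n * (real n - 4) \<le> -1" by (simp add: algebra_simps)
    moreover have "0 \<le> real n * (real n - 4)" using n by (intro mult_nonneg_nonneg) auto
    ultimately show False by simp
  qed
  \<comment> \<open>When one part is a single vertex, the cut term is exactly
    \<open>n (n - 1)\<close>. Only the parity correction is then left for the other part, which is
    the set \<open>S\<close> here; \<open>card S\<close> is even exactly when \<open>n\<close> is
    odd.\<close>
  have triv: "trivial_maximizer n M"
    if S: "S \<subseteq> {..<n}" "card S = n - 1"
      and le: "(\<Sum>u\<in>S. (excess M S u)\<^sup>2) \<le> real (n - 1) * of_bool (odd n)" for S
  proof -
    have "card ({..<n} - S) = 1"
      using card_Diff_subset[OF finite_subset[OF S(1)] S(1)] S(2) n by simp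
    then obtain v where v: "{..<n} - S = {v}" by (auto simp: card_1_singleton_iff)
    have vn: "v < n" and Sv: "S = {..<n} - {v}" using v S(1) by auto
    have "\<forall>u\<in>S. \<bar>excess M S u\<bar> \<le> 1"
      using excess_le_one_of_sum_squares[OF T S(1)] le S(2) n by simp
    then show ?thesis
      using regular_or_almost_regular_delete_iff[OF T vn] n vn M T
      unfolding trivial_maximizer_def adds_vertex_def Sv by auto
  qed
  show ?thesis using \<open>a = 1 \<or> b = 1\<close>
  proof
    assume "a = 1"
    then have "b = n - 1" using ab by simp
    moreover have "DB \<le> real (n - 1) * of_bool (odd n)"
      using bound nonneg(1) n \<open>a = 1\<close> \<open>b = n - 1\<close> by (simp add: of_nat_diff mult.commute)
    ultimately show ?thesis using triv[of B] B(1) by (simp add: DB_def b_def)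
  next
    assume "b = 1"
    then have "a = n - 1" using ab by simp
    moreover have "DA \<le> real (n - 1) * of_bool (odd n)"
      using bound nonneg(2) n \<open>b = 1\<close> \<open>a = n - 1\<close> by (simp add: of_nat_diff mult.commute)
    ultimately show ?thesis using triv[of A] by (simp add: DA_def a_def A_def)
  qed
qed

theorem proposition2p9:
  fixes n :: nat and M :: "real mat"
  assumes "n \<ge> 7" and "singular_C3_maximizer n M"
  shows "nontrivial_maximizer n M \<longleftrightarrow> strongly_connected (mat_digraph M)"
proof -
  have "\<not> strongly_connected (mat_digraph M)" if triv: "trivial_maximizer n M"
  proof -
    obtain v where "v < n" "regular_tournament (n - 1) (mat_delete M v v) \<or>
        almost_regular_tournament (n - 1) (mat_delete M v v)"
      using triv unfolding trivial_maximizer_def adds_vertex_def by blast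
    then show ?thesis
      using trivial_imp_not_strongly_connected[of n M v] assms
      by (simp add: singular_C3_maximizer_def singular_tournaments_def)
  qed
  moreover have "trivial_maximizer n M" if "\<not> strongly_connected (mat_digraph M)"
    using not_strongly_connected_imp_trivial[OF _ assms(2) that] assms(1) by simp
  ultimately show ?thesis using assms(2) by (auto simp: nontrivial_maximizer_def)
qed

end
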